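(* Let $m\in\mathbb{N}$, let $K\subset\mathbb{R}^2$ be a polygon with $N$ edges, let $\omega$ be a weight function on $[a,b]$, and suppose that the triple $\mathcal{A}_{m,N}=(\partial K,\mathcal{S}_m^0(\partial K),\Sigma_{\partial K})$ does not define a finite element. Let $\boldsymbol d=[d_1,\dots,d_{mN}]^T\neq 0$ be such that $\mathcal G=\sum_{j=1}^{mN}d_j\mathcal L_j$ vanishes on $\mathcal{S}_m^0(\partial K)$, with the basis functions $b_j$ enumerated so that $d_1\neq0$, and set $\widetilde f=b_1$. Then the enriched triple $$\widetilde{\mathcal A}_{m,N}=\bigl(\partial K,\ \widetilde{\mathcal S}^0_m(\partial K),\ \widetilde\Sigma_{\partial K}\bigr),\qquad \widetilde{\mathcal S}^0_m(\partial K)=\mathcal{S}_m^0(\partial K)\oplus\operatorname{span}\{\widetilde f\},\qquad \widetilde\Sigma_{\partial K}=\{\mathcal L_1,\dots,\mathcal L_{mN},\mathcal F\},$$ defines a finite element, i.e. the only $f\in\widetilde{\mathcal S}^0_m(\partial K)$ with $\mathcal L_j(f)=0$ for $j=1,\dots,mN$ and $\mathcal F(f)=0$ is $f=0$.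
   Context: $\mathbb{N}=\{1,2,\dots\}$, $\mathbb{N}_0=\mathbb{N}\cup\{0\}$, $a<b$ are real numbers. A weight function $\omega$ on $[a,b]$ is a nonnegative integrable function with $\int_a^b\omega(x)\,dx>0$ and all moments finite. $\{\pi_n\}_{n\in\mathbb{N}_0}$ is a sequence of orthogonal polynomials on $[a,b]$ with respect to $\omega$ ($\deg\pi_n=n$, $\int_a^b\pi_m\pi_n\omega\,dx=K_n\delta_{mn}$, $K_n\neq0$), and $\{\widehat\pi_n\}$ is the corresponding orthonormal sequence. $K$ has vertices $\mathbf v_1,\dots,\mathbf v_N$ ordered counter-clockwise, edges $e_i=[\mathbf v_i,\mathbf v_{i+1}]$, $\mathbf v_{N+1}=\mathbf v_1$. With $\psi_i(x)=\frac{b-x}{b-a}\mathbf v_i+\frac{x-a}{b-a}\mathbf v_{i+1}$, $x\in[a,b]$, put $\widetilde\gamma_i(u)(x)=u|_{e_i}(\psi_i(x))$. $\mathcal{S}_m(\partial K)$ is the space of $f\in L^2(\partial K)$ such that $f|_{e_i}$ is a polynomial of degree at most $m$ for each $i$ (no continuity at vertices), and $\mathcal{S}_m^0(\partial K)=\mathcal{S}_m(\partial K)\cap C^0(\partial K)$, of dimension $mN$. The basis $\{b_j:j=1,\dots,mN\}$ of $\mathcal{S}_{m-1}(\partial K)$ is an enumeration of functions $b_{\mu\nu}$, $\mu=1,\dots,N$, $\nu=0,\dots,m-1$, with $\widetilde\gamma_i(b_{\mu\nu})(x)=\widehat\pi_\nu(x)\delta_{i\mu}$. The functionals are $\mathcal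 L_j(f)=\sum_{i=1}^N\int_a^b\widetilde\gamma_i(f)\widetilde\gamma_i(b_j)\,\omega\,dx$, $\Sigma_{\partial K}=\{\mathcal L_j\}_{j=1}^{mN}$, and $$\mathcal F(f)=\sum_{i=1}^N\left(\frac{\pi_m(b)}{\pi_m(a)}\right)^{i-1}\int_a^b\widetilde\gamma_i(f)(x)\,\pi_m(x)\,\omega(x)\,dx .$$ The $\mathcal L_j$ and $\mathcal F$ are extended from $\mathcal{S}_m^0(\partial K)$ to $\widetilde{\mathcal S}^0_m(\partial K)$ by the same formulas. The triple $\mathcal A_{m,N}$ "defines a finite element" if the only $p\in\mathcal{S}_m^0(\partial K)$ with $\mathcal L_j(p)=0$ for all $j$ is $p=0$. When it does not, nonzero vectors $\boldsymbol d$ as in the claim exist. *)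

theory Defs
  imports "HOL-Analysis.Analysis" "HOL-Computational_Algebra.Polynomial"
begin

definition weight_function :: "real \<Rightarrow> real \<Rightarrow> (real \<Rightarrow> real) \<Rightarrow> bool" where
  "weight_function a b \<omega> \<longleftrightarrow>
     (\<forall>x\<in>{a..b}. 0 \<le> \<omega> x) \<and>
     set_integrable lebesgue {a..b} \<omega> \<and>
     0 < (LINT x:{a..b}|lebesgue. \<omega> x) \<and>
     (\<forall>k::nat. set_integrable lebesgue {a..b} (\<lambda>x. x ^ k * \<omega> x))"

definition orthogonal_polys ::
  "real \<Rightarrow> real \<Rightarrow> (real \<Rightarrow> real) \<Rightarrow> (nat \<Rightarrow> real poly) \<Rightarrow> bool" where
  "orthogonal_polys a b \<omega> \<pi> \<longleftrightarrow>
     (\<forall>n. degree (\<pi> n) = n) \<and>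
     (\<exists>K. (\<forall>n. K n \<noteq> 0) \<and>
        (\<forall>m n. (LINT x:{a..b}|lebesgue. poly (\<pi> m) x * poly (\<pi> n) x * \<omega> x)
                 = (if m = n then K n else 0)))"

definition orthonormalized ::
  "real \<Rightarrow> real \<Rightarrow> (real \<Rightarrow> real) \<Rightarrow> (nat \<Rightarrow> real poly) \<Rightarrow> nat \<Rightarrow> real poly" where
  "orthonormalized a b \<omega> \<pi> n =
     smult (1 / sqrt (LINT x:{a..b}|lebesgue. (poly (\<pi> n) x)\<^sup>2 * \<omega> x)) (\<pi> n)"

text \<open>The vertices are \<open>v 1, \<dots>, v N\<close>, continued by \<open>v (N + 1) = v 1\<close>; other values of \<open>v\<close>
  are irrelevant. The edges form a simple closed curve, and \<open>K\<close> is the closed region it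
  bounds: the bounded component of the complement of the curve is the only possible
  interior of a compact set with this frontier and nonempty interior. Positivity of
  twice the signed area (shoelace formula) says that the vertices are ordered
  counter-clockwise. Straight angles at vertices are allowed.\<close>

definition polygon :: "(real^2) set \<Rightarrow> nat \<Rightarrow> (nat \<Rightarrow> real^2) \<Rightarrow> bool" where
  "polygon K N v \<longleftrightarrow>
     3 \<le> N \<and> v (N + 1) = v 1 \<and> inj_on v {1..N} \<and>
     (\<forall>i\<in>{1..N}. \<forall>j\<in>{1..N}. i \<noteq> j \<longrightarrow>
        closed_segment (v i) (v (i + 1)) \<inter> closed_segment (v j) (v (j + 1))
          = {v i, v (i + 1)} \<inter> {v j, v (j + 1)}) \<and>
     0 < (\<Sum>i=1..N. v i $ 1 * v (i + 1) $ 2 - v (i + 1) $ 1 * v i $ 2) \<and>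
     compact K \<and> interior K \<noteq> {} \<and>
     frontier K = (\<Union>i\<in>{1..N}. closed_segment (v i) (v (i + 1)))"

definition edge_map :: "real \<Rightarrow> real \<Rightarrow> (nat \<Rightarrow> real^2) \<Rightarrow> nat \<Rightarrow> real \<Rightarrow> real^2" where
  "edge_map a b v i x = ((b - x) / (b - a)) *\<^sub>R v i + ((x - a) / (b - a)) *\<^sub>R v (i + 1)"

definition edge_trace ::
  "real \<Rightarrow> real \<Rightarrow> (nat \<Rightarrow> real^2) \<Rightarrow> nat \<Rightarrow> (real^2 \<Rightarrow> real) \<Rightarrow> real \<Rightarrow> real" where
  "edge_trace a b v i u x = u (edge_map a b v i x)"

text \<open>An element of \<open>L\<^sup>2(\<partial>K)\<close> is represented by a function on the plane, whose
  values off \<open>\<partial>K\<close> play no role; two representatives are identified if they agree almost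
  everywhere on \<open>\<partial>K\<close> with respect to arc length. Since each edge map has constant nonzero
  speed, null sets and square integrability for arc length can be read off from the
  parametrizations. All spaces below are closed under almost everywhere equality.\<close>

definition eq_ae_boundary ::
  "real \<Rightarrow> real \<Rightarrow> nat \<Rightarrow> (nat \<Rightarrow> real^2) \<Rightarrow> (real^2 \<Rightarrow> real) \<Rightarrow> (real^2 \<Rightarrow> real) \<Rightarrow> bool" where
  "eq_ae_boundary a b N v f g \<longleftrightarrow>
     (\<forall>i\<in>{1..N}. AE x in lebesgue. x \<in> {a..b} \<longrightarrow> edge_trace a b v i f x = edge_trace a b v i g x)"

definition L2_boundary ::
  "real \<Rightarrow> real \<Rightarrow> nat \<Rightarrow> (nat \<Rightarrow> real^2) \<Rightarrow> (real^2 \<Rightarrow> real) set" where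
  "L2_boundary a b N v =
     {f. \<forall>i\<in>{1..N}. set_borel_measurable lebesgue {a..b} (edge_trace a b v i f) \<and>
           set_integrable lebesgue {a..b} (\<lambda>x. (edge_trace a b v i f x)\<^sup>2)}"

definition S_space ::
  "real \<Rightarrow> real \<Rightarrow> nat \<Rightarrow> (nat \<Rightarrow> real^2) \<Rightarrow> nat \<Rightarrow> (real^2 \<Rightarrow> real) set" where
  "S_space a b N v m =
     {f \<in> L2_boundary a b N v. \<forall>i\<in>{1..N}. \<exists>p :: real poly. degree p \<le> m \<and>
        (AE x in lebesgue. x \<in> {a..b} \<longrightarrow> edge_trace a b v i f x = poly p x)}"

definition S0_space ::
  "real \<Rightarrow> real \<Rightarrow> (real^2) set \<Rightarrow> nat \<Rightarrow> (nat \<Rightarrow> real^2) \<Rightarrow> nat \<Rightarrow> (real^2 \<Rightarrow> real) set" where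
  "S0_space a b K N v m =
     {f \<in> S_space a b N v m. \<exists>g. continuous_on (frontier K) g \<and> eq_ae_boundary a b N v f g}"

definition line_span :: "(real^2 \<Rightarrow> real) \<Rightarrow> (real^2 \<Rightarrow> real) set" where
  "line_span h = {\<lambda>z. c * h z | c :: real. True}"

definition sum_space ::
  "(real^2 \<Rightarrow> real) set \<Rightarrow> (real^2 \<Rightarrow> real) set \<Rightarrow> (real^2 \<Rightarrow> real) set" where
  "sum_space V W = {\<lambda>z. f z + g z | f g. f \<in> V \<and> g \<in> W}"

definition basis_function ::
  "real \<Rightarrow> real \<Rightarrow> nat \<Rightarrow> (nat \<Rightarrow> real^2) \<Rightarrow> (real \<Rightarrow> real) \<Rightarrow> (nat \<Rightarrow> real poly)
    \<Rightarrow> nat \<times> nat \<Rightarrow> (real^2 \<Rightarrow> real) \<Rightarrow> bool" where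
  "basis_function a b N v \<omega> \<pi> = (\<lambda>(\<mu>, \<nu>) h.
     \<forall>i\<in>{1..N}. AE x in lebesgue. x \<in> {a..b} \<longrightarrow>
       edge_trace a b v i h x = (if i = \<mu> then poly (orthonormalized a b \<omega> \<pi> \<nu>) x else 0))"

definition moment_functional ::
  "real \<Rightarrow> real \<Rightarrow> nat \<Rightarrow> (nat \<Rightarrow> real^2) \<Rightarrow> (real \<Rightarrow> real)
    \<Rightarrow> (real^2 \<Rightarrow> real) \<Rightarrow> (real^2 \<Rightarrow> real) \<Rightarrow> real" where
  "moment_functional a b N v \<omega> h f =
     (\<Sum>i=1..N. LINT x:{a..b}|lebesgue. edge_trace a b v i f x * edge_trace a b v i h x * \<omega> x)"

definition extra_functional ::
  "real \<Rightarrow> real \<Rightarrow> nat \<Rightarrow> (nat \<Rightarrow> real^2) \<Rightarrow> (real \<Rightarrow> real) \<Rightarrow> (nat \<Rightarrow> real poly) \<Rightarrow> nat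
    \<Rightarrow> (real^2 \<Rightarrow> real) \<Rightarrow> real" where
  "extra_functional a b N v \<omega> \<pi> m f =
     (\<Sum>i=1..N. (poly (\<pi> m) b / poly (\<pi> m) a) ^ (i - 1) *
        (LINT x:{a..b}|lebesgue. edge_trace a b v i f x * poly (\<pi> m) x * \<omega> x))"

definition defines_finite_element ::
  "real \<Rightarrow> real \<Rightarrow> nat \<Rightarrow> (nat \<Rightarrow> real^2) \<Rightarrow> (real^2 \<Rightarrow> real) set
    \<Rightarrow> ((real^2 \<Rightarrow> real) \<Rightarrow> real) set \<Rightarrow> bool" where
  "defines_finite_element a b N v V \<Sigma> \<longleftrightarrow>
     (\<forall>f\<in>V. (\<forall>L\<in>\<Sigma>. L f = 0) \<longrightarrow> eq_ae_boundary a b N v f (\<lambda>_. 0))"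

end

theory Submission
  imports Defs
begin

text \<open>Let \<open>f = p + c b\<^sub>1\<close> with \<open>p\<close> continuous and piecewise polynomial be annihilated by all
  functionals. The functional \<open>G = \<Sum> d\<^sub>j L\<^sub>j\<close> vanishes on \<open>p\<close>, while orthonormality of the
  basis gives \<open>G(b\<^sub>1) = d\<^sub>1\<close>; hence \<open>c d\<^sub>1 = G(f) = 0\<close> and \<open>c = 0\<close>. A multiple
  \<open>c b\<^sub>1\<close> that is itself continuous has \<open>G(c b\<^sub>1) = 0\<close> as well, so again \<open>c = 0\<close>: the sum of
  the two spaces is direct.

  So \<open>f\<close> is continuous, and on each edge its trace is orthogonal to all polynomials of degree
  less than \<open>m\<close>, which forces it to be \<open>c\<^sub>i \<pi>\<^sub>m\<close> (\<open>orthogonal_below_imp_multiple\<close>). Since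
  \<open>\<pi>\<^sub>m(a) \<noteq> 0\<close> (\<open>\<pi>_left_end_nonzero\<close>), continuity at the vertices says \<open>c\<^sub>i = c\<^sub>1 r ^ (i - 1)\<close>
  with \<open>r = \<pi>\<^sub>m(b) / \<pi>\<^sub>m(a)\<close>. The extra functional has weights \<open>r ^ (i - 1)\<close>, so its value on
  \<open>f\<close> is \<open>c\<^sub>1\<close> times a positive number (\<open>S0_space_unisolvent\<close>), and \<open>c\<^sub>1 = 0\<close>.\<close>

section \<open>Functions equal almost everywhere\<close>

text \<open>Measurability of \<open>g\<close> is not assumed: it follows from completeness of the Lebesgue
  measure.\<close>

lemma set_lebesgue_integral_cong_AE_completion:
  fixes f g :: "real \<Rightarrow> real"
  assumes int: "set_integrable lebesgue A f"
    and ae: "AE x in lebesgue. x \<in> A \<longrightarrow> g x = f x"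
  shows "(LINT x:A|lebesgue. g x) = (LINT x:A|lebesgue. f x)"
proof -
  have eq: "AE x in lebesgue. indicator A x *\<^sub>R f x = indicator A x *\<^sub>R g x"
    using ae by (rule AE_mp) (auto split: split_indicator)
  have meas: "(\<lambda>x. indicator A x *\<^sub>R f x) \<in> borel_measurable lebesgue"
    using int by (auto simp: set_integrable_def)
  have "(\<lambda>x. indicator A x *\<^sub>R g x) \<in> borel_measurable lebesgue"
    by (rule borel_measurable_AE[OF meas eq])
  then show ?thesis
    unfolding set_lebesgue_integral_def using meas eq by (intro integral_cong_AE) auto
qed

lemma continuous_AE_eq_imp_eq:
  fixes f g :: "real \<Rightarrow> real"
  assumes "a < b" "continuous_on {a..b} f" "continuous_on {a..b} g"
    and ae: "AE x in lebesgue. x \<in> {a..b} \<longrightarrow> f x = g x"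
    and x: "x \<in> {a..b}"
  shows "f x = g x"
proof -
  obtain S where S: "negligible S" "{x. \<not> (x \<in> {a..b} \<longrightarrow> f x = g x)} \<subseteq> S"
    using ae by (auto simp: eventually_ae_filter_negligible)
  have "((\<lambda>x. \<bar>f x - g x\<bar>) has_integral 0) (cbox a b)"
    by (rule has_integral_negligible[OF S(1)]) (use S(2) in auto)
  moreover have "continuous_on (cbox a b) (\<lambda>x. \<bar>f x - g x\<bar>)"
    using assms by (auto intro!: continuous_intros)
  ultimately have "\<bar>f x - g x\<bar> = 0"
    using x \<open>a < b\<close>
    by (intro has_integral_0_cbox_imp_0[of a b "\<lambda>x. \<bar>f x - g x\<bar>"]) auto
  then show ?thesis by simp
qed


section \<open>Integration of polynomials against the weight\<close>

text \<open>A weight function on \<open>[a, b]\<close> together with a sequence of orthogonal polynomials for it.\<close>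

locale orthogonal_family =
  fixes a b :: real and \<omega> :: "real \<Rightarrow> real" and \<pi> :: "nat \<Rightarrow> real poly"
  assumes weight: "weight_function a b \<omega>"
    and orth: "orthogonal_polys a b \<omega> \<pi>"
begin

text \<open>The integral of a polynomial against the weight; \<open>wint (p * q)\<close> is the inner product
  of \<open>p\<close> and \<open>q\<close>.\<close>

definition wint :: "real poly \<Rightarrow> real" where
  "wint p = (LINT x:{a..b}|lebesgue. poly p x * \<omega> x)"

lemma poly_weight_integrable: "set_integrable lebesgue {a..b} (\<lambda>x. poly p x * \<omega> x)"
proof -
  have "set_integrable lebesgue {a..b} (\<lambda>x. coeff p i * (x ^ i * \<omega> x))" for i
    using weight by (intro set_integrable_mult_right) (auto simp: weight_function_def)
  then have "set_integrable lebesgue {a..b} (\<lambda>x. \<Sum>i\<le>degree p. coeff p i * (x ^ i * \<omega> x))"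
    unfolding set_integrable_def scaleR_sum_right by (rule Bochner_Integration.integrable_sum)
  then show ?thesis
    by (simp add: poly_altdef sum_distrib_right mult.assoc)
qed

lemma wint_add: "wint (p + q) = wint p + wint q"
  unfolding wint_def using poly_weight_integrable[of p] poly_weight_integrable[of q]
  by (simp add: distrib_right)

lemma wint_smult: "wint (smult c p) = c * wint p"
  by (simp add: wint_def mult.assoc)

lemma wint_0 [simp]: "wint 0 = 0"
  by (simp add: wint_def)

lemma wint_diff: "wint (p - q) = wint p - wint q"
  using wint_add[of "p - q" q] by simp

text \<open>A nonzero polynomial has only finitely many roots, so if the integral vanishes, the
  nonnegative integrand can only be null when \<open>\<omega> = 0\<close> almost everywhere.\<close>

lemma wint_nonneg_eq_0_imp_0:
  assumes nonneg: "\<And>x. x \<in> {a..b} \<Longrightarrow> 0 \<le> poly p x" and 0: "wint p = 0"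
  shows "p = 0"
proof (rule ccontr)
  assume "p \<noteq> 0"
  have "AE x in lebesgue. indicator {a..b} x *\<^sub>R (poly p x * \<omega> x) = 0"
    using 0 poly_weight_integrable[of p] nonneg weight
    unfolding wint_def set_lebesgue_integral_def set_integrable_def weight_function_def
    by (subst (asm) integral_nonneg_eq_0_iff_AE) (auto split: split_indicator)
  moreover have "AE x in lebesgue. x \<notin> {x. poly p x = 0}"
    using poly_roots_finite[OF \<open>p \<noteq> 0\<close>]
    by (intro AE_not_in null_sets_completionI finite_imp_null_set_lborel)
  ultimately have "AE x in lebesgue. indicator {a..b} x *\<^sub>R \<omega> x = 0"
    by eventually_elim (auto split: split_indicator)
  then have "(LINT x:{a..b}|lebesgue. \<omega> x) = 0"
    unfolding set_lebesgue_integral_def by (rule integral_eq_zero_AE)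
  then show False
    using weight by (simp add: weight_function_def)
qed

lemma wint_square_eq_0_imp_0: "wint (p * p) = 0 \<Longrightarrow> p = 0"
  using wint_nonneg_eq_0_imp_0[of "p * p"] by simp


section \<open>Orthogonal polynomials\<close>

lemma degree_\<pi> [simp]: "degree (\<pi> n) = n"
  using orth by (simp add: orthogonal_polys_def)

lemma \<pi>_nonzero [simp]: "\<pi> n \<noteq> 0"
proof
  assume "\<pi> n = 0"
  moreover have "wint (\<pi> n * \<pi> n) \<noteq> 0"
    using orth by (auto simp: orthogonal_polys_def wint_def)
  ultimately show False by simp
qed

lemma wint_\<pi>_neq: "k \<noteq> n \<Longrightarrow> wint (\<pi> k * \<pi> n) = 0"
  using orth by (auto simp: orthogonal_polys_def wint_def)

lemma wint_\<pi>_square_pos: "0 < wint (\<pi> n * \<pi> n)"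
proof -
  have "0 \<le> wint (\<pi> n * \<pi> n)"
    unfolding wint_def set_lebesgue_integral_def
    using weight by (intro integral_nonneg_AE AE_I2)
      (auto simp: weight_function_def split: split_indicator)
  then show ?thesis
    using wint_square_eq_0_imp_0[of "\<pi> n"] by fastforce
qed

lemma coeff_\<pi>_nonzero: "coeff (\<pi> n) n \<noteq> 0"
  using leading_coeff_neq_0[OF \<pi>_nonzero[of n]] by simp

text \<open>Such a \<open>q\<close> is a combination of \<open>\<pi> 0, \<dots>, \<pi> (n - 1)\<close>. The degree bound is stated through
  vanishing coefficients so that \<open>n = 0\<close> means \<open>q = 0\<close>, which starts the induction.\<close>

lemma wint_eq_0_if_orthogonal_below:
  assumes "\<And>i. n \<le> i \<Longrightarrow> coeff q i = 0" and "\<And>k. k < n \<Longrightarrow> wint (r * \<pi> k) = 0"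
  shows "wint (r * q) = 0"
  using assms
proof (induction n arbitrary: q)
  case 0
  then have "q = 0" by (intro poly_eqI) auto
  then show ?case by simp
next
  case (Suc n)
  define c where "c = coeff q n / coeff (\<pi> n) n"
  have "wint (r * (q - smult c (\<pi> n))) = 0"
  proof (rule Suc.IH)
    fix i assume "n \<le> i"
    show "coeff (q - smult c (\<pi> n)) i = 0"
    proof (cases "i = n")
      case True
      then show ?thesis using coeff_\<pi>_nonzero[of n] by (simp add: c_def)
    next
      case False
      then have "coeff q i = 0" "coeff (\<pi> n) i = 0"
        using \<open>n \<le> i\<close> Suc.prems(1)[of i] by (auto intro: coeff_eq_0)
      then show ?thesis by simp
    qed
  qed (use Suc.prems in auto)
  then show ?case
    using Suc.prems(2)[of n] by (simp add: right_diff_distrib wint_diff wint_smult)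
qed

lemma orthogonal_below_imp_multiple:
  assumes "degree p \<le> m" and "\<And>k. k < m \<Longrightarrow> wint (p * \<pi> k) = 0"
  shows "\<exists>c. p = smult c (\<pi> m)"
proof -
  define c where "c = coeff p m / coeff (\<pi> m) m"
  define q where "q = p - smult c (\<pi> m)"
  have "coeff q i = 0" if "m \<le> i" for i
  proof (cases "i = m")
    case True
    then show ?thesis using coeff_\<pi>_nonzero[of m] by (simp add: q_def c_def)
  next
    case False
    then have "coeff p i = 0" "coeff (\<pi> m) i = 0"
      using that assms(1) by (auto intro!: coeff_eq_0)
    then show ?thesis by (simp add: q_def)
  qed
  moreover have "wint (q * \<pi> k) = 0" if "k < m" for k
    using that assms(2)[of k] wint_\<pi>_neq[of m k]
    by (simp add: q_def left_diff_distrib wint_diff wint_smult)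
  ultimately have "wint (q * q) = 0"
    by (rule wint_eq_0_if_orthogonal_below)
  then have "q = 0" by (rule wint_square_eq_0_imp_0)
  then show ?thesis by (auto simp: q_def)
qed

text \<open>If \<open>\<pi> n = (x - a) q\<close>, then \<open>(x - a) q\<^sup>2 \<ge> 0\<close> on \<open>[a, b]\<close>, while its weighted integral
  vanishes because \<open>q\<close> has degree less than \<open>n\<close>.\<close>

lemma \<pi>_left_end_nonzero: "poly (\<pi> n) a \<noteq> 0"
proof
  assume "poly (\<pi> n) a = 0"
  then obtain q where q: "\<pi> n = [:- a, 1:] * q"
    by (auto simp: poly_eq_0_iff_dvd)
  then have "q \<noteq> 0" using \<pi>_nonzero[of n] by auto
  then have n: "n = Suc (degree q)"
    using degree_\<pi>[of n] degree_mult_eq[of "[:- a, 1:]" q] q by simp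
  have "wint (\<pi> n * q) = 0"
  proof (rule wint_eq_0_if_orthogonal_below)
    show "coeff q i = 0" if "n \<le> i" for i
      by (rule coeff_eq_0) (use that n in linarith)
    show "wint (\<pi> n * \<pi> k) = 0" if "k < n" for k
      by (rule wint_\<pi>_neq) (use that in simp)
  qed
  moreover have "poly (\<pi> n * q) x = (x - a) * (poly q x * poly q x)" for x
    by (simp add: q algebra_simps)
  then have "0 \<le> poly (\<pi> n * q) x" if "x \<in> {a..b}" for x
    using that by (metis atLeastAtMost_iff diff_ge_0_iff_ge mult_nonneg_nonneg zero_le_square)
  ultimately have "\<pi> n * q = 0"
    by (intro wint_nonneg_eq_0_imp_0) auto
  then show False using \<open>q \<noteq> 0\<close> by simp
qed

lemma orthonormalized_eq:
  "orthonormalized a b \<omega> \<pi> n = smult (1 / sqrt (wint (\<pi> n * \<pi> n))) (\<pi> n)"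
  by (simp add: orthonormalized_def wint_def power2_eq_square)

lemma wint_orthonormalized:
  "wint (orthonormalized a b \<omega> \<pi> k * orthonormalized a b \<omega> \<pi> n) = (if k = n then 1 else 0)"
  using wint_\<pi>_square_pos[of n] wint_\<pi>_neq[of k n]
  by (auto simp: orthonormalized_eq wint_smult)

lemma wint_mult_orthonormalized_eq_0:
  "wint (p * orthonormalized a b \<omega> \<pi> n) = 0 \<longleftrightarrow> wint (p * \<pi> n) = 0"
  using wint_\<pi>_square_pos[of n] by (simp add: orthonormalized_eq wint_smult)


section \<open>Piecewise polynomials on the boundary\<close>

text \<open>\<open>has_traces N v f P\<close>: on the edge \<open>i\<close> the function \<open>f\<close> is represented, up to a null set,
  by the polynomial \<open>P i\<close> in the edge parameter.\<close>

definition has_traces ::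
  "nat \<Rightarrow> (nat \<Rightarrow> real^2) \<Rightarrow> (real^2 \<Rightarrow> real) \<Rightarrow> (nat \<Rightarrow> real poly) \<Rightarrow> bool" where
  "has_traces N v f P \<longleftrightarrow> (\<forall>i\<in>{1..N}. AE x in lebesgue.
     x \<in> {a..b} \<longrightarrow> edge_trace a b v i f x = poly (P i) x)"

lemma has_tracesD:
  "has_traces N v f P \<Longrightarrow> i \<in> {1..N} \<Longrightarrow>
    AE x in lebesgue. x \<in> {a..b} \<longrightarrow> edge_trace a b v i f x = poly (P i) x"
  by (simp add: has_traces_def)

lemma has_traces_lincomb:
  assumes "has_traces N v f P" "has_traces N v h Q"
  shows "has_traces N v (\<lambda>z. f z + c * h z) (\<lambda>i. P i + smult c (Q i))"
  unfolding has_traces_def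
proof
  fix i assume i: "i \<in> {1..N}"
  show "AE x in lebesgue. x \<in> {a..b} \<longrightarrow>
      edge_trace a b v i (\<lambda>z. f z + c * h z) x = poly (P i + smult c (Q i)) x"
    using has_tracesD[OF assms(1) i] has_tracesD[OF assms(2) i]
    by eventually_elim (auto simp: edge_trace_def)
qed

lemma moment_functional_eq:
  assumes "has_traces N v h Q" "has_traces N v f P"
  shows "moment_functional a b N v \<omega> h f = (\<Sum>i=1..N. wint (P i * Q i))"
  unfolding moment_functional_def wint_def
proof (intro sum.cong refl set_lebesgue_integral_cong_AE_completion poly_weight_integrable)
  fix i assume i: "i \<in> {1..N}"
  show "AE x in lebesgue. x \<in> {a..b} \<longrightarrow>
      edge_trace a b v i f x * edge_trace a b v i h x * \<omega> x = poly (P i * Q i) x * \<omega> x"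
    using has_tracesD[OF assms(1) i] has_tracesD[OF assms(2) i]
    by eventually_elim auto
qed

lemma extra_functional_eq:
  assumes "has_traces N v f P"
  shows "extra_functional a b N v \<omega> \<pi> m f =
    (\<Sum>i=1..N. (poly (\<pi> m) b / poly (\<pi> m) a) ^ (i - 1) * wint (P i * \<pi> m))"
proof -
  have "(LINT x:{a..b}|lebesgue. edge_trace a b v i f x * poly (\<pi> m) x * \<omega> x) =
      wint (P i * \<pi> m)" if i: "i \<in> {1..N}" for i
    unfolding wint_def
  proof (intro set_lebesgue_integral_cong_AE_completion poly_weight_integrable)
    show "AE x in lebesgue. x \<in> {a..b} \<longrightarrow>
        edge_trace a b v i f x * poly (\<pi> m) x * \<omega> x = poly (P i * \<pi> m) x * \<omega> x"
      using has_tracesD[OF assms i] by eventually_elim auto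
  qed
  then show ?thesis by (simp add: extra_functional_def)
qed

lemma moment_functional_lincomb:
  assumes "has_traces N v h Q" "has_traces N v f P" "has_traces N v g R"
  shows "moment_functional a b N v \<omega> h (\<lambda>z. f z + c * g z) =
    moment_functional a b N v \<omega> h f + c * moment_functional a b N v \<omega> h g"
  using assms moment_functional_eq[OF assms(1) has_traces_lincomb[OF assms(2,3), of c]]
  by (simp add: moment_functional_eq distrib_right wint_add wint_smult sum.distrib sum_distrib_left)

lemma basis_function_has_traces:
  "basis_function a b N v \<omega> \<pi> (\<mu>, \<nu>) h \<Longrightarrow>
    has_traces N v h (\<lambda>i. if i = \<mu> then orthonormalized a b \<omega> \<pi> \<nu> else 0)"
  by (auto simp: basis_function_def has_traces_def if_distrib[of "\<lambda>p. poly p _"] cong: if_cong)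

lemma moment_functional_basis:
  assumes h: "basis_function a b N v \<omega> \<pi> (\<mu>, \<nu>) h" and \<mu>: "\<mu> \<in> {1..N}"
    and f: "has_traces N v f P"
  shows "moment_functional a b N v \<omega> h f = wint (P \<mu> * orthonormalized a b \<omega> \<pi> \<nu>)"
proof -
  have "moment_functional a b N v \<omega> h f =
      (\<Sum>i=1..N. if i = \<mu> then wint (P i * orthonormalized a b \<omega> \<pi> \<nu>) else 0)"
    by (subst moment_functional_eq[OF basis_function_has_traces[OF h] f])
       (intro sum.cong refl, simp)
  also have "\<dots> = wint (P \<mu> * orthonormalized a b \<omega> \<pi> \<nu>)"
    using \<mu> by (subst sum.delta) auto
  finally show ?thesis .
qed

lemma moment_functional_basis_basis:
  assumes h: "basis_function a b N v \<omega> \<pi> (\<mu>, \<nu>) h" and \<mu>: "\<mu> \<in> {1..N}"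
    and f: "basis_function a b N v \<omega> \<pi> (\<mu>', \<nu>') f"
  shows "moment_functional a b N v \<omega> h f = (if (\<mu>, \<nu>) = (\<mu>', \<nu>') then 1 else 0)"
  by (subst moment_functional_basis[OF h \<mu> basis_function_has_traces[OF f]])
     (auto simp: wint_orthonormalized)

text \<open>The values of the edge polynomials match at the vertices \<open>v 2, \<dots>, v N\<close>; the matching at
  \<open>v 1\<close>, where the curve closes up, is not needed.\<close>

lemma S0_space_traces:
  assumes "a < b" and poly: "polygon K N v" and f: "f \<in> S0_space a b K N v m"
  obtains P where "has_traces N v f P" "\<And>i. i \<in> {1..N} \<Longrightarrow> degree (P i) \<le> m"
    "\<And>i. i \<in> {1..<N} \<Longrightarrow> poly (P (Suc i)) a = poly (P i) b"
proof -
  obtain g where g: "continuous_on (frontier K) g" "eq_ae_boundary a b N v f g"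
    using f by (auto simp: S0_space_def)
  have "\<forall>i\<in>{1..N}. \<exists>p. degree p \<le> m \<and>
      (AE x in lebesgue. x \<in> {a..b} \<longrightarrow> edge_trace a b v i f x = poly p x)"
    using f by (auto simp: S0_space_def S_space_def)
  then obtain P where P: "\<And>i. i \<in> {1..N} \<Longrightarrow> degree (P i) \<le> m"
    "has_traces N v f P"
    unfolding has_traces_def by metis
  have eq: "edge_trace a b v i g x = poly (P i) x" if i: "i \<in> {1..N}" and x: "x \<in> {a..b}" for i x
  proof (rule continuous_AE_eq_imp_eq[OF \<open>a < b\<close> _ _ _ x])
    have "edge_map a b v i ` {a..b} \<subseteq> closed_segment (v i) (v (i + 1))"
    proof (rule image_subsetI)
      fix t assume "t \<in> {a..b}"
      moreover have "(b - t) / (b - a) = 1 - (t - a) / (b - a)"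
        using \<open>a < b\<close> by (simp add: field_simps)
      ultimately show "edge_map a b v i t \<in> closed_segment (v i) (v (i + 1))"
        using \<open>a < b\<close> unfolding edge_map_def in_segment
        by (intro exI[of _ "(t - a) / (b - a)"]) (auto simp: field_simps)
    qed
    also have "\<dots> \<subseteq> frontier K"
      using poly i unfolding polygon_def by blast
    finally have "edge_map a b v i ` {a..b} \<subseteq> frontier K" .
    moreover have "continuous_on {a..b} (edge_map a b v i)"
      using \<open>a < b\<close> unfolding edge_map_def by (intro continuous_intros) auto
    ultimately show "continuous_on {a..b} (edge_trace a b v i g)"
      unfolding edge_trace_def using g(1) by (blast intro: continuous_on_compose2)
    show "continuous_on {a..b} (poly (P i))"
      by (intro continuous_intros)
    have "AE x in lebesgue. x \<in> {a..b} \<longrightarrow> edge_trace a b v i f x = edge_trace a b v i g x"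
      using g(2) i by (simp add: eq_ae_boundary_def)
    then show "AE x in lebesgue. x \<in> {a..b} \<longrightarrow> edge_trace a b v i g x = poly (P i) x"
      using has_tracesD[OF P(2) i] by eventually_elim auto
  qed
  have "poly (P (Suc i)) a = poly (P i) b" if "i \<in> {1..<N}" for i
  proof -
    have "edge_map a b v (Suc i) a = edge_map a b v i b"
      using \<open>a < b\<close> by (simp add: edge_map_def)
    then show ?thesis
      using that \<open>a < b\<close> eq[of "Suc i" a] eq[of i b] by (simp add: edge_trace_def)
  qed
  then show ?thesis using that P by blast
qed


section \<open>Unisolvence\<close>

text \<open>A continuous piecewise polynomial whose traces are orthogonal to all lower degrees is a
  multiple of the one with traces \<open>r ^ (i - 1) \<cdot> \<pi> m\<close>, where \<open>r = \<pi> m b / \<pi> m a\<close>; the extra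
  functional takes on it a sum of even powers of \<open>r\<close> times a positive number.\<close>

lemma S0_space_unisolvent:
  assumes "a < b" "polygon K N v" "f \<in> S0_space a b K N v m"
    and mom: "\<And>P i k. has_traces N v f P \<Longrightarrow> i \<in> {1..N} \<Longrightarrow> k < m \<Longrightarrow> wint (P i * \<pi> k) = 0"
    and extra: "extra_functional a b N v \<omega> \<pi> m f = 0"
  shows "eq_ae_boundary a b N v f (\<lambda>_. 0)"
proof -
  obtain P where P: "has_traces N v f P" "\<And>i. i \<in> {1..N} \<Longrightarrow> degree (P i) \<le> m"
    "\<And>i. i \<in> {1..<N} \<Longrightarrow> poly (P (Suc i)) a = poly (P i) b"
    using S0_space_traces[OF assms(1-3)] by metis
  define r where "r = poly (\<pi> m) b / poly (\<pi> m) a"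
  define w where "w = wint (\<pi> m * \<pi> m)"
  have "\<forall>i\<in>{1..N}. \<exists>c. P i = smult c (\<pi> m)"
    using orthogonal_below_imp_multiple P(2) mom[OF P(1)] by blast
  then obtain c where c: "\<And>i. i \<in> {1..N} \<Longrightarrow> P i = smult (c i) (\<pi> m)"
    by metis
  have c_Suc: "c (Suc i) = c i * r" if "i \<in> {1..<N}" for i
    using P(3)[OF that] c[of i] c[of "Suc i"] that \<pi>_left_end_nonzero[of m]
    by (simp add: r_def field_simps)
  have c_eq: "c (Suc i) = c 1 * r ^ i" if "i < N" for i
    using that by (induction i) (auto simp: c_Suc)
  have "1 \<le> N" using assms(2) by (simp add: polygon_def)
  have "0 = (\<Sum>i=1..N. r ^ (i - 1) * wint (P i * \<pi> m))"
    using extra extra_functional_eq[OF P(1)] by (simp add: r_def)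
  also have "\<dots> = (\<Sum>i=1..N. c 1 * w * (r ^ (i - 1))\<^sup>2)"
  proof (rule sum.cong[OF refl])
    fix i assume i: "i \<in> {1..N}"
    then have "c i = c 1 * r ^ (i - 1)" using c_eq[of "i - 1"] by auto
    then show "r ^ (i - 1) * wint (P i * \<pi> m) = c 1 * w * (r ^ (i - 1))\<^sup>2"
      using c[OF i] by (simp add: wint_smult w_def power2_eq_square)
  qed
  also have "\<dots> = c 1 * w * (\<Sum>i=1..N. (r ^ (i - 1))\<^sup>2)"
    by (simp add: sum_distrib_left)
  finally have "c 1 * w * (\<Sum>i=1..N. (r ^ (i - 1))\<^sup>2) = 0" by simp
  moreover have "0 < (\<Sum>i=1..N. (r ^ (i - 1))\<^sup>2)"
    \<comment> \<open>the summand for the first edge is 1\<close>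
    using \<open>1 \<le> N\<close> by (intro sum_pos2[of _ 1]) auto
  moreover have "w > 0" unfolding w_def by (rule wint_\<pi>_square_pos)
  ultimately have "c 1 = 0" by simp
  then have "P i = 0" if "i \<in> {1..N}" for i
    using c[OF that] c_eq[of "i - 1"] that by auto
  then show ?thesis
    using has_tracesD[OF P(1)] by (auto simp: eq_ae_boundary_def edge_trace_def)
qed

end

theorem theorem5:
  fixes a b :: real and m N :: nat and K :: "(real^2) set" and v :: "nat \<Rightarrow> real^2"
    and \<omega> :: "real \<Rightarrow> real" and \<pi> :: "nat \<Rightarrow> real poly"
    and e :: "nat \<Rightarrow> nat \<times> nat" and bas :: "nat \<Rightarrow> real^2 \<Rightarrow> real"
    and \<L> :: "nat \<Rightarrow> (real^2 \<Rightarrow> real) \<Rightarrow> real" and d :: "nat \<Rightarrow> real"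
  assumes "a < b"
    and "1 \<le> m"
    and "polygon K N v"
    and "weight_function a b \<omega>"
    and "orthogonal_polys a b \<omega> \<pi>"
    and "bij_betw e {1..m * N} ({1..N} \<times> {0..m - 1})"
    and "\<And>j. j \<in> {1..m * N} \<Longrightarrow> basis_function a b N v \<omega> \<pi> (e j) (bas j)"
    and "\<And>j. j \<in> {1..m * N} \<Longrightarrow> \<L> j = moment_functional a b N v \<omega> (bas j)"
    and "\<not> defines_finite_element a b N v (S0_space a b K N v m) (\<L> ` {1..m * N})"
    and "\<exists>j\<in>{1..m * N}. d j \<noteq> 0"
    and "\<And>p. p \<in> S0_space a b K N v m \<Longrightarrow> (\<Sum>j=1..m * N. d j * \<L> j p) = 0"
    and "d 1 \<noteq> 0"
  shows "(\<forall>g \<in> S0_space a b K N v m \<inter> line_span (bas 1). eq_ae_boundary a b N v g (\<lambda>_. 0)) \<and>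
    defines_finite_element a b N v
      (sum_space (S0_space a b K N v m) (line_span (bas 1)))
      (insert (extra_functional a b N v \<omega> \<pi> m) (\<L> ` {1..m * N}))"
proof -
  interpret orthogonal_family a b \<omega> \<pi>
    using assms(4,5) by unfold_locales
  let ?V = "S0_space a b K N v m" and ?J = "{1..m * N}"
  have "3 \<le> N" using assms(3) by (simp add: polygon_def)
  then have one: "1 \<in> ?J" using \<open>1 \<le> m\<close> by simp
  have basis: "basis_function a b N v \<omega> \<pi> (fst (e j), snd (e j)) (bas j)"
    "fst (e j) \<in> {1..N}" if "j \<in> ?J" for j
    using assms(7)[OF that] bij_betwE[OF assms(6)] that by (auto simp: mem_Times_iff)
  have L_bas1: "\<L> j (bas 1) = (if j = 1 then 1 else 0)" if "j \<in> ?J" for j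
  proof -
    have "e j = e 1 \<longleftrightarrow> j = 1"
      using inj_on_eq_iff[OF bij_betw_imp_inj_on[OF assms(6)] that one] .
    then show ?thesis
      using assms(8)[OF that] moment_functional_basis_basis[OF basis[OF that] basis(1)[OF one]]
      by simp
  qed
  have G_bas1: "(\<Sum>j\<in>?J. d j * (c * \<L> j (bas 1))) = c * d 1" for c
  proof -
    have "(\<Sum>j\<in>?J. d j * (c * \<L> j (bas 1))) = (\<Sum>j\<in>?J. if j = 1 then c * d j else 0)"
      by (intro sum.cong refl) (simp add: L_bas1 del: One_nat_def)
    then show ?thesis using one by (simp add: sum.delta)
  qed
  have L_lincomb: "\<L> j (\<lambda>z. p z + c * bas 1 z) = \<L> j p + c * \<L> j (bas 1)"
    if j: "j \<in> ?J" and p: "p \<in> ?V" for j p c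
  proof -
    obtain P where P: "has_traces N v p P"
      using S0_space_traces[OF assms(1,3) p] by metis
    show ?thesis
      using moment_functional_lincomb[OF basis_function_has_traces[OF basis(1)[OF j]] P
          basis_function_has_traces[OF basis(1)[OF one]]]
      by (simp add: assms(8)[OF j])
  qed
  have "eq_ae_boundary a b N v g (\<lambda>_. 0)" if g: "g \<in> ?V \<inter> line_span (bas 1)" for g
  proof -
    obtain c where c: "g = (\<lambda>z. c * bas 1 z)"
      using g by (auto simp: line_span_def)
    have "\<L> j g = c * \<L> j (bas 1)" if "j \<in> ?J" for j
      by (simp add: assms(8)[OF that] c moment_functional_def edge_trace_def mult.assoc sum_distrib_left)
    then have "(\<Sum>j\<in>?J. d j * \<L> j g) = c * d 1"
      using G_bas1[of c] by simp
    then have "c = 0" using assms(11)[of g] g \<open>d 1 \<noteq> 0\<close> by simp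
    then show ?thesis by (simp add: c eq_ae_boundary_def)
  qed
  moreover have "eq_ae_boundary a b N v f (\<lambda>_. 0)"
    if f: "f \<in> sum_space ?V (line_span (bas 1))"
      and Lf: "\<And>j. j \<in> ?J \<Longrightarrow> \<L> j f = 0" and Ff: "extra_functional a b N v \<omega> \<pi> m f = 0" for f
  proof -
    obtain p c where p: "p \<in> ?V" and fp: "f = (\<lambda>z. p z + c * bas 1 z)"
      using f by (auto simp: sum_space_def line_span_def)
    have "0 = (\<Sum>j\<in>?J. d j * \<L> j f)"
      using Lf by simp
    also have "\<dots> = (\<Sum>j\<in>?J. d j * \<L> j p) + (\<Sum>j\<in>?J. d j * (c * \<L> j (bas 1)))"
      unfolding fp sum.distrib[symmetric]
      by (intro sum.cong refl) (simp add: L_lincomb p distrib_left del: One_nat_def)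
    also have "\<dots> = c * d 1"
      by (simp only: G_bas1 assms(11)[OF p] add_0)
    finally have "c = 0" using \<open>d 1 \<noteq> 0\<close> by simp
    then have "f \<in> ?V" using p by (simp add: fp)
    moreover have "wint (P i * \<pi> k) = 0"
      if P: "has_traces N v f P" and i: "i \<in> {1..N}" and k: "k < m" for P i k
    proof -
      have "(i, k) \<in> e ` ?J"
        using bij_betw_imp_surj_on[OF assms(6)] i k by auto
      then obtain j where j: "j \<in> ?J" "e j = (i, k)" by auto
      then have "wint (P i * orthonormalized a b \<omega> \<pi> k) = 0"
        using moment_functional_basis[OF basis[OF j(1)] P] Lf[OF j(1)] assms(8)[OF j(1)] by simp
      then show ?thesis by (simp only: wint_mult_orthonormalized_eq_0)
    qed
    ultimately show ?thesis
      using S0_space_unisolvent[OF assms(1,3)] Ff by blast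
  qed
  ultimately show ?thesis
    unfolding defines_finite_element_def by (intro conjI ballI impI) auto
qed

end
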